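(* Let $n,k$ be nonnegative integers with $k\le 2n-7$. Then each indecomposable permutation $\pi\in\mathrm{Av}_n^k(1324)$ is almost decomposable.
   Context: $\mathrm{Av}_n^k(\tau)$ is the set of permutations $\pi=\pi_1\ldots\pi_n\in\mathfrak S_n$ that avoid the pattern $\tau$ (in the classical sense: no subsequence of $\pi$ is order-isomorphic to $\tau$) and have exactly $k$ inversions, i.e. pairs $i<j$ with $\pi_i>\pi_j$. The direct sum of $\sigma\in\mathfrak S_a$ and $\tau\in\mathfrak S_b$ is $\sigma\oplus\tau\in\mathfrak S_{a+b}$ with $(\sigma\oplus\tau)(i)=\sigma(i)$ for $i\le a$ and $(\sigma\oplus\tau)(i)=a+\tau(i-a)$ for $i>a$. A permutation is decomposable if it is the direct sum of two nonempty permutations, and indecomposable otherwise. For $\pi\in\mathfrak S_n$ and a value $v\in[n]$, $\pi\smallsetminus v$ denotes the permutation in $\mathfrak S_{n-1}$ order-isomorphic to the sequence obtained by removing the entry with value $v$ from $\pi_1\ldots\pi_n$ (so $\pi\smallsetminus\pi_i$ removes the entry in position $i$). A permutation $\pi\in\mathfrak S_n$ is almost decomposable if it is indecomposable, but at least one of $\pi\smallsetminus 1$, $\pi\smallsetminus n$, $\pi\smallsetminus\pi_1$, $\pi\smallsetminus\pi_n$ is decomposable. *)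

theory Defs
  imports Main "HOL-Library.Sublist" "HOL-Combinatorics.Multiset_Permutations"
begin

text \<open>
  Permutations are represented in one-line notation, i.e. by the list of their values
  \<open>\<pi>\<^sub>1 \<dots> \<pi>\<^sub>n\<close>. The values are \<open>1, \<dots>, n\<close>, whereas list positions are counted
  from \<open>0\<close>, so that \<open>\<pi>\<^sub>i\<close> is \<open>\<pi> ! (i - 1)\<close>.
\<close>

abbreviation perms :: "nat \<Rightarrow> nat list set" where
  "perms n \<equiv> permutations_of_set {1..n}"

definition order_isomorphic :: "nat list \<Rightarrow> nat list \<Rightarrow> bool" where
  "order_isomorphic xs ys \<longleftrightarrow>
     length xs = length ys \<and>
     (\<forall>i < length xs. \<forall>j < length xs. xs ! i < xs ! j \<longleftrightarrow> ys ! i < ys ! j)"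

definition avoids :: "nat list \<Rightarrow> nat list \<Rightarrow> bool" where
  "avoids \<pi> \<tau> \<longleftrightarrow> \<not> (\<exists>xs. subseq xs \<pi> \<and> order_isomorphic xs \<tau>)"

definition inversions :: "nat list \<Rightarrow> (nat \<times> nat) set" where
  "inversions \<pi> = {(i, j). i < j \<and> j < length \<pi> \<and> \<pi> ! i > \<pi> ! j}"

definition Av :: "nat \<Rightarrow> nat \<Rightarrow> nat list \<Rightarrow> nat list set" where
  "Av n k \<tau> = {\<pi> \<in> perms n. avoids \<pi> \<tau> \<and> card (inversions \<pi>) = k}"

definition direct_sum :: "nat list \<Rightarrow> nat list \<Rightarrow> nat list" where
  "direct_sum \<sigma> \<tau> = \<sigma> @ map (\<lambda>x. length \<sigma> + x) \<tau>"

definition decomposable :: "nat list \<Rightarrow> bool" where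
  "decomposable \<pi> \<longleftrightarrow>
     (\<exists>a b \<sigma> \<tau>. a > 0 \<and> b > 0 \<and> \<sigma> \<in> perms a \<and> \<tau> \<in> perms b \<and> \<pi> = direct_sum \<sigma> \<tau>)"

abbreviation indecomposable :: "nat list \<Rightarrow> bool" where
  "indecomposable \<pi> \<equiv> \<not> decomposable \<pi>"

text \<open>
  The standardization replaces each entry by its rank. The lemmas below show that, for a
  sequence of distinct entries, it is the unique permutation order-isomorphic to the sequence.
\<close>

definition standardize :: "nat list \<Rightarrow> nat list" where
  "standardize xs = map (\<lambda>x. card {y \<in> set xs. y \<le> x}) xs"

definition remove_value :: "nat list \<Rightarrow> nat \<Rightarrow> nat list" where
  "remove_value \<pi> v = standardize (removeAll v \<pi>)"

definition almost_decomposable :: "nat list \<Rightarrow> bool" where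
  "almost_decomposable \<pi> \<longleftrightarrow>
     indecomposable \<pi> \<and>
     (decomposable (remove_value \<pi> 1) \<or>
      decomposable (remove_value \<pi> (length \<pi>)) \<or>
      decomposable (remove_value \<pi> (hd \<pi>)) \<or>
      decomposable (remove_value \<pi> (last \<pi>)))"

lemma rank_less_iff:
  fixes A :: "nat set"
  assumes "finite A" "x \<in> A" "y \<in> A"
  shows "card {z \<in> A. z \<le> x} < card {z \<in> A. z \<le> y} \<longleftrightarrow> x < y"
proof
  assume "x < y"
  then have "{z \<in> A. z \<le> x} \<subseteq> {z \<in> A. z \<le> y}" "y \<in> {z \<in> A. z \<le> y}"
    "y \<notin> {z \<in> A. z \<le> x}"
    using assms by auto
  then have "{z \<in> A. z \<le> x} \<subset> {z \<in> A. z \<le> y}" by blast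
  moreover have "finite {z \<in> A. z \<le> y}" using assms by simp
  ultimately show "card {z \<in> A. z \<le> x} < card {z \<in> A. z \<le> y}"
    by (rule psubset_card_mono[rotated])
next
  assume *: "card {z \<in> A. z \<le> x} < card {z \<in> A. z \<le> y}"
  show "x < y"
  proof (rule ccontr)
    assume "\<not> x < y"
    then have "card {z \<in> A. z \<le> y} \<le> card {z \<in> A. z \<le> x}"
      using assms by (intro card_mono) auto
    with * show False by simp
  qed
qed

lemma order_isomorphic_standardize: "order_isomorphic (standardize xs) xs"
  by (simp add: order_isomorphic_def standardize_def rank_less_iff)

lemma standardize_in_perms:
  assumes "distinct xs"
  shows "standardize xs \<in> perms (length xs)"
proof -
  let ?r = "\<lambda>x. card {y \<in> set xs. y \<le> x}"
  have inj: "inj_on ?r (set xs)"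
  proof (rule inj_onI)
    fix x y assume "x \<in> set xs" "y \<in> set xs" "?r x = ?r y"
    then show "x = y"
      using rank_less_iff[of "set xs" x y] rank_less_iff[of "set xs" y x] by simp
  qed
  have "?r ` set xs \<subseteq> {1..length xs}"
  proof
    fix r assume "r \<in> ?r ` set xs"
    then obtain x where x: "x \<in> set xs" "r = ?r x" by blast
    have "card {x} \<le> ?r x" by (rule card_mono) (use x in simp_all)
    moreover have "?r x \<le> card (set xs)" by (rule card_mono) auto
    moreover have "card (set xs) \<le> length xs" by (rule card_length)
    ultimately show "r \<in> {1..length xs}" using x by simp
  qed
  moreover have "card (?r ` set xs) = length xs"
    using inj assms by (simp add: card_image distinct_card)
  ultimately have "?r ` set xs = {1..length xs}"
    by (simp add: card_subset_eq)
  then show ?thesis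
    using inj assms by (simp add: permutations_of_set_def standardize_def distinct_map)
qed

lemma standardize_cong:
  assumes "order_isomorphic xs ys" "distinct xs" "distinct ys"
  shows "standardize xs = standardize ys"
proof (rule nth_equalityI)
  show "length (standardize xs) = length (standardize ys)"
    using assms by (simp add: standardize_def order_isomorphic_def)
next
  fix i assume "i < length (standardize xs)"
  then have i: "i < length xs" by (simp add: standardize_def)
  have len: "length xs = length ys" using assms by (simp add: order_isomorphic_def)
  have rank: "card {y \<in> set zs. y \<le> zs ! i} = card {j. j < length zs \<and> zs ! j \<le> zs ! i}"
    if "distinct zs" for zs :: "nat list"
  proof -
    have "{y \<in> set zs. y \<le> zs ! i} = (!) zs ` {j. j < length zs \<and> zs ! j \<le> zs ! i}"
      by (auto simp: in_set_conv_nth)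
    moreover have "inj_on ((!) zs) {j. j < length zs \<and> zs ! j \<le> zs ! i}"
      using that by (auto simp: inj_on_def nth_eq_iff_index_eq)
    ultimately show ?thesis by (simp add: card_image)
  qed
  have "{j. j < length xs \<and> xs ! j \<le> xs ! i} = {j. j < length ys \<and> ys ! j \<le> ys ! i}"
    using assms(1) i by (auto simp: order_isomorphic_def not_less[symmetric])
  then show "standardize xs ! i = standardize ys ! i"
    using i len rank[OF assms(2)] rank[OF assms(3)] by (simp add: standardize_def)
qed

lemma standardize_perm:
  assumes "\<pi> \<in> perms n"
  shows "standardize \<pi> = \<pi>"
proof -
  have "card {y \<in> set \<pi>. y \<le> x} = x" if "x \<in> set \<pi>" for x
  proof -
    have "{y \<in> set \<pi>. y \<le> x} = {1..x}"
      using assms that by (auto simp: permutations_of_set_def)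
    then show ?thesis by simp
  qed
  then show ?thesis by (simp add: standardize_def map_idI)
qed

lemma standardize_unique:
  assumes "distinct xs" "\<pi> \<in> perms n" "order_isomorphic \<pi> xs"
  shows "\<pi> = standardize xs"
  using standardize_cong[OF assms(3)] standardize_perm[OF assms(2)] assms(1,2)
  by (simp add: permutations_of_set_def)

end

theory Submission
  imports Defs
begin

text \<open>
  The theorem is proved in contrapositive form: an indecomposable 1324-avoider of size \<open>n\<close> that is
  not almost decomposable has at least \<open>2n - 6\<close> inversions. For a cut between the first \<open>j\<close>
  positions and the rest, let \<open>c\<^sub>j\<close> be the number of entries left of the cut with value above \<open>j\<close>;
  equally many entries right of it have value at most \<open>j\<close> (\<open>card_crossings_eq\<close>). The sum of all
  \<open>c\<^sub>j\<close> is at most the number of inversions (\<open>crossings_le_inversions\<close>), so if \<open>c\<^sub>j \<ge> 2\<close> for all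
  \<open>2 \<le> j \<le> n - 2\<close>, there are at least \<open>2(n - 3)\<close> inversions.

  Otherwise some such cut has \<open>c\<^sub>j = 1\<close>, as \<open>c\<^sub>j = 0\<close> would make the permutation decomposable. Then
  the permutation consists of one high entry \<open>b\<close> left of the cut, one low entry \<open>a\<close> right of it, a
  nonempty set \<open>P\<close> of entries to the lower left and a nonempty set \<open>Q\<close> to the upper right. The
  inversions are those inside \<open>P \<union> {a, b}\<close> and those inside \<open>Q \<union> {a, b}\<close>, and only the inversion
  formed by \<open>b\<close> and \<open>a\<close> occurs in both. The core is \<open>side_bound\<close>: there are at least \<open>2|P| - 1\<close>
  inversions inside \<open>P \<union> {a, b}\<close>, and even \<open>2|P|\<close> unless some \<open>x\<close> in \<open>P\<close> is to the lower left of
  both \<open>a\<close> and \<open>b\<close>. By rotating the diagram by a half turn the same holds for \<open>Q\<close>, with some \<open>y\<close> to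
  the upper right of both. Such \<open>x\<close> and \<open>y\<close> cannot both exist, since \<open>x, b, a, y\<close> would be an
  occurrence of 1324. Hence there are at least \<open>2|P| + 2|Q| - 2 = 2n - 6\<close> inversions
  (\<open>cut_bound\<close>).

  For \<open>side_bound\<close>, note that \<open>P\<close> avoids 132, because an entry of \<open>Q\<close> could play the role of 4.
  If \<open>M\<close> is the largest entry of \<open>P\<close>, then all entries of \<open>P\<close> up to \<open>M\<close> exceed all entries of \<open>P\<close>
  after \<open>M\<close>, which yields a product of two cardinalities as number of inversions. The cases where
  this is too small are those where a point at a corner of the diagram can be removed; there the
  assumption that the permutation is not almost decomposable is used.
\<close>

section \<open>Point diagrams\<close>

text \<open>
  A permutation is viewed as a set of points \<open>v\<close> with coordinates \<open>X v\<close> (position) and \<open>Y v\<close>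
  (value). The coordinates are parameters, so that inverting the permutation amounts to exchanging
  \<open>X\<close> and \<open>Y\<close>, and reversing and complementing it to negating both.

  \<open>splits X Y S\<close> is decomposability of \<open>S\<close>: one nonempty part lies to the lower left of the rest.
\<close>

definition splits :: "('v \<Rightarrow> int) \<Rightarrow> ('v \<Rightarrow> int) \<Rightarrow> 'v set \<Rightarrow> bool" where
  "splits X Y S \<longleftrightarrow> (\<exists>A B. A \<noteq> {} \<and> B \<noteq> {} \<and> A \<union> B = S \<and>
     (\<forall>u\<in>A. \<forall>v\<in>B. X u < X v \<and> Y u < Y v))"

text \<open>The inversions of a diagram, each oriented with its left (and higher) point first.\<close>

definition inv_pairs :: "('v \<Rightarrow> int) \<Rightarrow> ('v \<Rightarrow> int) \<Rightarrow> 'v set \<Rightarrow> ('v \<times> 'v) set" where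
  "inv_pairs X Y S = {(u, v). u \<in> S \<and> v \<in> S \<and> X u < X v \<and> Y v < Y u}"

text \<open>Pattern avoidance for diagrams, with the points of an occurrence named from left to right.\<close>

definition avoids_132 :: "('v \<Rightarrow> int) \<Rightarrow> ('v \<Rightarrow> int) \<Rightarrow> 'v set \<Rightarrow> bool" where
  "avoids_132 X Y S \<longleftrightarrow> (\<forall>u\<in>S. \<forall>v\<in>S. \<forall>w\<in>S.
     X u < X v \<longrightarrow> X v < X w \<longrightarrow> \<not> (Y u < Y w \<and> Y w < Y v))"

definition avoids_1324 :: "('v \<Rightarrow> int) \<Rightarrow> ('v \<Rightarrow> int) \<Rightarrow> 'v set \<Rightarrow> bool" where
  "avoids_1324 X Y S \<longleftrightarrow> (\<forall>u\<in>S. \<forall>v\<in>S. \<forall>w\<in>S. \<forall>z\<in>S.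
     X u < X v \<longrightarrow> X v < X w \<longrightarrow> X w < X z \<longrightarrow> \<not> (Y u < Y w \<and> Y w < Y v \<and> Y v < Y z))"

lemma splitsI:
  assumes "A \<noteq> {}" "B \<noteq> {}" "A \<union> B = S" "\<And>u v. u \<in> A \<Longrightarrow> v \<in> B \<Longrightarrow> X u < X v \<and> Y u < Y v"
  shows "splits X Y S"
  using assms unfolding splits_def by blast

lemma splits_swap: "splits Y X S \<longleftrightarrow> splits X Y S"
  unfolding splits_def by (simp add: conj_commute)

lemma splits_uminus: "splits (\<lambda>v. - X v) (\<lambda>v. - Y v) S \<longleftrightarrow> splits X Y S"
proof -
  have "splits (\<lambda>v. - X v) (\<lambda>v. - Y v) S" if "splits X Y S" for X Y :: "'a \<Rightarrow> int"
  proof -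
    from that obtain A B where "A \<noteq> {}" "B \<noteq> {}" "A \<union> B = S"
      "\<forall>u\<in>A. \<forall>v\<in>B. X u < X v \<and> Y u < Y v" unfolding splits_def by blast
    then show ?thesis by (intro splitsI[of B A]) auto
  qed
  from this[of X Y] this[of "\<lambda>v. - X v" "\<lambda>v. - Y v"] show ?thesis by auto
qed

lemma inv_pairs_swap: "card (inv_pairs Y X S) = card (inv_pairs X Y S)"
proof -
  have "inv_pairs Y X S = prod.swap ` inv_pairs X Y S"
    unfolding inv_pairs_def by (auto simp: image_iff)
  then show ?thesis by (simp add: card_image)
qed

lemma inv_pairs_uminus:
  "card (inv_pairs (\<lambda>v. - X v) (\<lambda>v. - Y v) S) = card (inv_pairs X Y S)"
proof -
  have "inv_pairs (\<lambda>v. - X v) (\<lambda>v. - Y v) S = prod.swap ` inv_pairs X Y S"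
    unfolding inv_pairs_def by (auto simp: image_iff)
  then show ?thesis by (simp add: card_image)
qed

lemma avoids_132_swap:
  assumes "avoids_132 X Y S"
  shows "avoids_132 Y X S"
  unfolding avoids_132_def
proof (intro ballI impI notI)
  fix u v w assume *: "u \<in> S" "v \<in> S" "w \<in> S" "Y u < Y v" "Y v < Y w" "X u < X w \<and> X w < X v"
  then show False using assms unfolding avoids_132_def by blast
qed

lemma avoids_132_mono: "avoids_132 X Y S \<Longrightarrow> T \<subseteq> S \<Longrightarrow> avoids_132 X Y T"
  unfolding avoids_132_def by blast

lemma avoids_1324_uminus:
  assumes "avoids_1324 X Y S"
  shows "avoids_1324 (\<lambda>v. - X v) (\<lambda>v. - Y v) S"
  unfolding avoids_1324_def
proof (intro ballI impI notI)
  fix u v w z assume *: "u \<in> S" "v \<in> S" "w \<in> S" "z \<in> S" "- X u < - X v" "- X v < - X w"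
    "- X w < - X z" "- Y u < - Y w \<and> - Y w < - Y v \<and> - Y v < - Y z"
  then have "X z < X w" "X w < X v" "X v < X u" "Y z < Y v \<and> Y v < Y w \<and> Y w < Y u" by auto
  with *(1-4) assms show False unfolding avoids_1324_def by blast
qed

lemma finite_inv_pairs: "finite S \<Longrightarrow> finite (inv_pairs X Y S)"
  by (rule finite_subset[of _ "S \<times> S"]) (auto simp: inv_pairs_def)

lemma inv_pairs_mono: "T \<subseteq> S \<Longrightarrow> finite S \<Longrightarrow> card (inv_pairs X Y T) \<le> card (inv_pairs X Y S)"
  by (rule card_mono[OF finite_inv_pairs]) (auto simp: inv_pairs_def)

lemma inv_pairs_skew:
  assumes "finite A" "finite B"
    and "\<And>u v. u \<in> A \<Longrightarrow> v \<in> B \<Longrightarrow> X u < X v \<and> Y v < Y u"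
  shows "card (inv_pairs X Y A) + card (inv_pairs X Y B) + card A * card B
    \<le> card (inv_pairs X Y (A \<union> B))"
proof -
  have disj: "A \<inter> B = {}" using assms(3) by fastforce
  have fin: "finite (inv_pairs X Y A)" "finite (inv_pairs X Y B)" "finite (A \<times> B)"
    using assms by (auto simp: finite_inv_pairs)
  have "card (inv_pairs X Y A \<union> inv_pairs X Y B \<union> A \<times> B)
      = card (inv_pairs X Y A \<union> inv_pairs X Y B) + card (A \<times> B)"
    using disj fin by (intro card_Un_disjoint) (auto simp: inv_pairs_def)
  also have "card (inv_pairs X Y A \<union> inv_pairs X Y B) = card (inv_pairs X Y A) + card (inv_pairs X Y B)"
    using disj fin by (intro card_Un_disjoint) (auto simp: inv_pairs_def)
  finally have "card (inv_pairs X Y A) + card (inv_pairs X Y B) + card A * card B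
      = card (inv_pairs X Y A \<union> inv_pairs X Y B \<union> A \<times> B)"
    by (simp add: card_cartesian_product)
  also have "\<dots> \<le> card (inv_pairs X Y (A \<union> B))"
    using assms by (intro card_mono finite_inv_pairs) (auto simp: inv_pairs_def)
  finally show ?thesis .
qed

section \<open>One side of a cut that is crossed once in each direction\<close>

text \<open>
  The geometry on the lower left of a cut crossed only by \<open>b\<close> (left of the cut, above it) and \<open>a\<close>
  (right of the cut, below it). A point of \<open>P\<close> forms an inversion with \<open>a\<close> iff it is above \<open>a\<close>, and
  with \<open>b\<close> iff it is to the right of \<open>b\<close>.
\<close>

definition side :: "('v \<Rightarrow> int) \<Rightarrow> ('v \<Rightarrow> int) \<Rightarrow> 'v set \<Rightarrow> 'v \<Rightarrow> 'v \<Rightarrow> bool" where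
  "side X Y P a b \<longleftrightarrow> finite P \<and> inj_on X (P \<union> {a, b}) \<and> inj_on Y (P \<union> {a, b}) \<and>
     (\<forall>p\<in>P. X p < X a \<and> Y p < Y b) \<and> X b < X a \<and> Y a < Y b"

text \<open>
  What \<open>P \<union> {a, b}\<close> inherits from an indecomposable 1324-avoider that is not almost decomposable:
  it does not split, not even after removal of its lowest or its leftmost point. The last two
  conditions arise from a case distinction. If \<open>a\<close> is the last entry of the whole permutation, then
  \<open>P \<union> {b}\<close> does not split, because the permutation without \<open>a\<close> does not, and otherwise \<open>P \<union> {a}\<close> avoids 132, a later entry being
  a possible 4; similarly for \<open>b\<close> with the largest value.
\<close>

definition tight :: "('v \<Rightarrow> int) \<Rightarrow> ('v \<Rightarrow> int) \<Rightarrow> 'v set \<Rightarrow> 'v \<Rightarrow> 'v \<Rightarrow> bool" where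
  "tight X Y P a b \<longleftrightarrow> avoids_132 X Y P \<and> \<not> splits X Y (P \<union> {a, b}) \<and>
     (\<forall>m\<in>P \<union> {a, b}. (\<forall>v\<in>P \<union> {a, b}. Y m \<le> Y v) \<longrightarrow> \<not> splits X Y (P \<union> {a, b} - {m})) \<and>
     (\<forall>m\<in>P \<union> {a, b}. (\<forall>v\<in>P \<union> {a, b}. X m \<le> X v) \<longrightarrow> \<not> splits X Y (P \<union> {a, b} - {m})) \<and>
     (\<not> splits X Y (P \<union> {b}) \<or> avoids_132 X Y (P \<union> {a})) \<and>
     (\<not> splits X Y (P \<union> {a}) \<or> avoids_132 X Y (P \<union> {b}))"

lemma side_swap: "side X Y P a b \<Longrightarrow> side Y X P b a"
  unfolding side_def by (auto simp: insert_commute)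

lemma tight_swap: "tight X Y P a b \<Longrightarrow> tight Y X P b a"
  unfolding tight_def splits_swap[of Y X]
  by (auto simp: insert_commute avoids_132_swap)

lemma side_notin: "side X Y P a b \<Longrightarrow> a \<notin> P \<and> b \<notin> P \<and> a \<noteq> b"
  unfolding side_def by auto

lemma side_subset: "side X Y P a b \<Longrightarrow> N \<subseteq> P \<Longrightarrow> side X Y N a b"
  unfolding side_def by (auto intro: finite_subset inj_on_subset)

lemma inv_pairs_side:
  assumes "side X Y P a b"
  shows "card (inv_pairs X Y (P \<union> {a, b})) =
    card (inv_pairs X Y P) + card {p\<in>P. Y a < Y p} + card {p\<in>P. X b < X p} + 1"
proof -
  have fin: "finite P" using assms by (simp add: side_def)
  have ni: "a \<notin> P" "b \<notin> P" "a \<noteq> b" using side_notin[OF assms] by auto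
  have finI: "finite (inv_pairs X Y P)" using fin by (rule finite_inv_pairs)
  let ?A = "(\<lambda>p. (p, a)) ` {p\<in>P. Y a < Y p}" and ?B = "(\<lambda>p. (b, p)) ` {p\<in>P. X b < X p}"
  have eq: "inv_pairs X Y (P \<union> {a, b}) = ((inv_pairs X Y P \<union> ?A) \<union> ?B) \<union> {(b, a)}"
    using assms unfolding inv_pairs_def side_def by force
  have c1: "card ?A = card {p\<in>P. Y a < Y p}" "card ?B = card {p\<in>P. X b < X p}"
    by (auto intro!: card_image simp: inj_on_def)
  have "card (((inv_pairs X Y P \<union> ?A) \<union> ?B) \<union> {(b, a)}) = card ((inv_pairs X Y P \<union> ?A) \<union> ?B) + 1"
    using fin finI ni by (subst card_Un_disjoint) (auto simp: inv_pairs_def)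
  also have "card ((inv_pairs X Y P \<union> ?A) \<union> ?B) = card (inv_pairs X Y P \<union> ?A) + card ?B"
    using fin finI ni by (intro card_Un_disjoint) (auto simp: inv_pairs_def)
  also have "card (inv_pairs X Y P \<union> ?A) = card (inv_pairs X Y P) + card ?A"
    using fin finI ni by (intro card_Un_disjoint) (auto simp: inv_pairs_def)
  finally show ?thesis using eq c1 by simp
qed

text \<open>
  If all points of \<open>Z\<close> are below \<open>t\<close> and one of them, \<open>z\<close>, is to the right of \<open>t\<close>, then every point of
  \<open>Z\<close> has its own inversion: with \<open>t\<close> if it is to the right of \<open>t\<close>, and otherwise with \<open>z\<close>, since
  else it would form a 132 with \<open>t\<close> and \<open>z\<close>.
\<close>

lemma attached_count_aux:
  assumes fin: "finite N" and av: "avoids_132 X Y N"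
    and inj: "inj_on X N" "inj_on Y N"
    and Z: "Z \<subseteq> N" and t: "t \<in> N" "\<And>z. z \<in> Z \<Longrightarrow> Y z < Y t"
    and z: "z \<in> Z" "X t < X z"
  shows "card Z \<le> card (inv_pairs X Y N)"
proof -
  let ?f = "\<lambda>u. if X t < X u then (t, u) else (u, z)"
  have "?f ` Z \<subseteq> inv_pairs X Y N"
  proof
    fix e assume "e \<in> ?f ` Z"
    then obtain u where u: "u \<in> Z" "e = ?f u" by blast
    show "e \<in> inv_pairs X Y N"
    proof (cases "X t < X u")
      case True
      then show ?thesis using u Z t unfolding inv_pairs_def by auto
    next
      case False
      have "u \<noteq> t" using t(2)[OF u(1)] by auto
      then have "X u < X t" using False inj(1) u Z t(1) by (force simp: inj_on_def)
      moreover have "u \<noteq> z" using False z by auto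
      then have "Y u \<noteq> Y z" using inj(2) u z Z by (auto simp: inj_on_def)
      moreover have "\<not> Y u < Y z"
        using av \<open>X u < X t\<close> z t u Z unfolding avoids_132_def by blast
      ultimately show ?thesis using u Z z False unfolding inv_pairs_def by auto
    qed
  qed
  moreover have "inj_on ?f Z"
    using z t(2) by (fastforce simp: inj_on_def split: if_splits)
  ultimately show ?thesis
    using card_inj_on_le finite_inv_pairs[OF fin] by blast
qed

text \<open>
  This is the bound of \<open>|N| + 1\<close> edges for a connected inversion graph on the \<open>|N| + 2\<close> points of
  \<open>N \<union> {a, b}\<close>, with the edge between \<open>a\<close> and \<open>b\<close> left out. Avoidance of 132 permits a direct proof:
  the points of \<open>N\<close> without an inversion with \<open>a\<close> or \<open>b\<close> are counted by the preceding lemma.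
\<close>

lemma attached_count:
  assumes s: "side X Y N a b" and av: "avoids_132 X Y N" and ns: "\<not> splits X Y (N \<union> {a, b})"
  shows "card N \<le> card (inv_pairs X Y N) + card {p\<in>N. Y a < Y p} + card {p\<in>N. X b < X p}"
proof -
  define Z where "Z = {p\<in>N. Y p < Y a \<and> X p < X b}"
  define T where "T = {p\<in>N. Y a < Y p} \<union> {p\<in>N. X b < X p}"
  have fin: "finite N" and inj: "inj_on X (N \<union> {a, b})" "inj_on Y (N \<union> {a, b})"
    and pos: "\<forall>p\<in>N. X p < X a \<and> Y p < Y b" "X b < X a" "Y a < Y b"
    using s unfolding side_def by auto
  have ni: "a \<notin> N" "b \<notin> N" using side_notin[OF s] by auto
  have injN: "inj_on X N" "inj_on Y N" using inj by (auto intro: inj_on_subset)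
  have ne: "Y p \<noteq> Y a" "X p \<noteq> X b" if "p \<in> N" for p
    using inj that ni by (auto simp: inj_on_def)
  have NZT: "N = Z \<union> T" unfolding Z_def T_def using ne by fastforce
  have cT: "card T \<le> card {p\<in>N. Y a < Y p} + card {p\<in>N. X b < X p}"
    unfolding T_def by (rule card_Un_le)
  have cN: "card N \<le> card Z + card T" using NZT card_Un_le by metis
  have "card Z \<le> card (inv_pairs X Y N)"
  proof (cases "Z = {}")
    case False
    have "\<exists>z\<in>Z. \<exists>t\<in>T. \<not> (X z < X t \<and> Y z < Y t)"
    proof (rule ccontr)
      assume c: "\<not> ?thesis"
      have "splits X Y (N \<union> {a, b})"
      proof (rule splitsI[of Z "T \<union> {a, b}"])
        show "Z \<union> (T \<union> {a, b}) = N \<union> {a, b}" using NZT by blast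
        show "X u < X v \<and> Y u < Y v" if "u \<in> Z" "v \<in> T \<union> {a, b}" for u v
        proof -
          have "u \<in> N" "Y u < Y a" "X u < X b" using that(1) unfolding Z_def by auto
          moreover have "X u < X v \<and> Y u < Y v" if "v \<in> T" using c \<open>u \<in> Z\<close> that by blast
          ultimately show ?thesis using pos \<open>v \<in> T \<union> {a, b}\<close> by auto
        qed
      qed (use False in auto)
      then show False using ns by blast
    qed
    then obtain z t where zt: "z \<in> Z" "t \<in> T" "\<not> (X z < X t \<and> Y z < Y t)" by blast
    have zN: "z \<in> N" "t \<in> N" "z \<noteq> t" using zt unfolding Z_def T_def by auto
    have ZN: "Z \<subseteq> N" unfolding Z_def by auto
    show ?thesis
    proof (cases "Y a < Y t")
      case True
      then have "\<And>u. u \<in> Z \<Longrightarrow> Y u < Y t" unfolding Z_def by auto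
      moreover have "X t < X z"
        using zt(1,3) True zN injN(1) calculation by (force simp: inj_on_def)
      ultimately show ?thesis
        using attached_count_aux[OF fin av injN ZN zN(2)] zt(1) by blast
    next
      case False
      then have "X b < X t" using zt(2) unfolding T_def by auto
      then have "\<And>u. u \<in> Z \<Longrightarrow> X u < X t" unfolding Z_def by auto
      moreover have "Y t < Y z"
        using zt(1,3) zN injN(2) calculation by (force simp: inj_on_def)
      ultimately have "card Z \<le> card (inv_pairs Y X N)"
        using attached_count_aux[OF fin avoids_132_swap[OF av] injN(2,1) ZN zN(2)] zt(1) by blast
      then show ?thesis by (simp add: inv_pairs_swap)
    qed
  qed simp
  then show ?thesis using cN cT by linarith
qed

text \<open>
  The case that \<open>b\<close> forms no inversion with \<open>P\<close>. Then \<open>P \<union> {b}\<close> splits, so that \<open>P \<union> {a}\<close> avoids 132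
  and the part \<open>U\<close> of \<open>P\<close> above \<open>a\<close> precedes the part \<open>W\<close> below \<open>a\<close>. All \<open>|U| |W|\<close> pairs are
  inversions, and so are the \<open>|U|\<close> pairs with \<open>a\<close>; the bound follows from \<open>|U| \<ge> 2\<close> and \<open>|W| \<ge> 1\<close>.
\<close>

lemma side_bound_unattached:
  assumes s: "side X Y P a b" and g: "tight X Y P a b" and ne: "P \<noteq> {}"
    and left: "\<And>p. p \<in> P \<Longrightarrow> X p < X b"
  shows "2 * card P \<le> card (inv_pairs X Y (P \<union> {a, b})) + 1"
    and "\<exists>x\<in>P. X x < X b \<and> Y x < Y a"
proof -
  have fin: "finite P" and inj: "inj_on X (P \<union> {a, b})" "inj_on Y (P \<union> {a, b})"
    and pos: "\<forall>p\<in>P. X p < X a \<and> Y p < Y b" "X b < X a" "Y a < Y b"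
    using s unfolding side_def by auto
  have ni: "a \<notin> P" "b \<notin> P" "a \<noteq> b" using side_notin[OF s] by auto
  have Yne: "Y p \<noteq> Y a" if "p \<in> P" for p
    using inj that ni by (auto simp: inj_on_def)
  define U where "U = {p\<in>P. Y a < Y p}"
  define W where "W = {p\<in>P. Y p < Y a}"
  have UW: "P = U \<union> W" "U \<inter> W = {}" unfolding U_def W_def using Yne by force+
  have finUW: "finite U" "finite W" using fin UW by auto
  have sb: "splits X Y (P \<union> {b})"
    by (rule splitsI[of P "{b}"]) (use ne left pos in auto)
  then have av: "avoids_132 X Y (P \<union> {a})" using g unfolding tight_def by blast
  have Wne: "W \<noteq> {}"
  proof
    assume "W = {}"
    then have "P \<subseteq> U" using UW by simp
    then have "\<forall>v\<in>P \<union> {a, b}. Y a \<le> Y v" using pos unfolding U_def by fastforce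
    then have "\<not> splits X Y (P \<union> {a, b} - {a})" using g unfolding tight_def by blast
    moreover have "P \<union> {a, b} - {a} = P \<union> {b}" using ni by auto
    ultimately show False using sb by simp
  qed
  then show "\<exists>x\<in>P. X x < X b \<and> Y x < Y a" using left unfolding W_def by auto
  have Une: "U \<noteq> {}"
  proof
    assume "U = {}"
    then have "P \<subseteq> W" using UW by simp
    then have "\<And>p. p \<in> P \<Longrightarrow> Y p < Y a" unfolding W_def by blast
    then have "splits X Y (P \<union> {a, b})"
      by (intro splitsI[of P "{a, b}"]) (use ne left pos in auto)
    then show False using g unfolding tight_def by blast
  qed
  have skew: "X u < X w \<and> Y w < Y u" if "u \<in> U" "w \<in> W" for u w
  proof -
    have uw: "u \<in> P" "w \<in> P" "Y w < Y a" "Y a < Y u" using that unfolding U_def W_def by auto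
    have "\<not> X w < X u"
      using av[unfolded avoids_132_def, rule_format, of w u a] uw pos(1) by blast
    moreover have "X u \<noteq> X w" using uw inj_onD[OF inj(1), of u w] by auto
    ultimately show ?thesis using uw by auto
  qed
  \<comment> \<open>A single point of \<open>U\<close> would be leftmost, and its removal would split off \<open>W\<close>.\<close>
  have "card U \<noteq> 1"
  proof
    assume "card U = 1"
    then obtain u where u: "U = {u}" by (auto simp: card_1_singleton_iff)
    have "u \<in> P" using u UW by auto
    have "\<forall>v\<in>P \<union> {a, b}. X u \<le> X v"
      using UW u skew left pos by (fastforce intro: less_imp_le)
    then have "\<not> splits X Y (P \<union> {a, b} - {u})" using g \<open>u \<in> P\<close> unfolding tight_def by blast
    moreover have "P \<union> {a, b} - {u} = W \<union> {a, b}" using UW u ni \<open>u \<in> P\<close> by auto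
    moreover have "splits X Y (W \<union> {a, b})"
      by (rule splitsI[of W "{a, b}"]) (use Wne left pos in \<open>auto simp: W_def\<close>)
    ultimately show False by simp
  qed
  then have "card U \<ge> 2" using Une finUW card_0_eq[of U] by linarith
  moreover have "card W \<ge> 1" using Wne finUW card_0_eq[of W] by linarith
  ultimately obtain u w where uw: "card U = u + 2" "card W = w + 1"
    by (metis add.commute le_Suc_ex)
  have "card U * card W \<le> card (inv_pairs X Y P)"
    using inv_pairs_skew[of U W X Y, OF finUW skew] UW(1) by simp
  moreover have "card P = card U + card W"
    using UW finUW by (metis card_Un_disjoint)
  moreover have "card (inv_pairs X Y (P \<union> {a, b})) \<ge> card (inv_pairs X Y P) + card U + 1"
    unfolding inv_pairs_side[OF s] U_def by simp
  ultimately show "2 * card P \<le> card (inv_pairs X Y (P \<union> {a, b})) + 1"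
    unfolding uw by (simp add: algebra_simps)
qed

text \<open>
  A point \<open>M\<close> to the upper right of the rest of \<open>P\<close> is irrelevant for splitting: in a splitting of a
  set containing \<open>a\<close> or \<open>b\<close>, the lower left part lies in \<open>P\<close>, so \<open>M\<close> can join the upper right part.
\<close>

lemma tight_remove_corner:
  assumes s: "side X Y P a b" and g: "tight X Y P a b" and M: "M \<in> P"
    and top: "\<And>p. p \<in> P - {M} \<Longrightarrow> X p < X M \<and> Y p < Y M" and ne: "P - {M} \<noteq> {}"
  shows "tight X Y (P - {M}) a b"
proof -
  let ?N = "P - {M}"
  have pos: "\<forall>p\<in>P. X p < X a \<and> Y p < Y b" "X b < X a" "Y a < Y b"
    using s unfolding side_def by auto
  have ni: "a \<notin> P" "b \<notin> P" "a \<noteq> b" using side_notin[OF s] by auto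
  have up: "splits X Y (insert M T)" if T: "T \<subseteq> ?N \<union> {a, b}" "T \<inter> {a, b} \<noteq> {}" "splits X Y T" for T
  proof -
    obtain A B where AB: "A \<noteq> {}" "B \<noteq> {}" "A \<union> B = T"
      "\<forall>u\<in>A. \<forall>v\<in>B. X u < X v \<and> Y u < Y v" using T(3) unfolding splits_def by blast
    have B: "\<exists>v\<in>B. v \<in> ?N \<or> v = a \<or> v = b" using AB T(1) by blast
    have "a \<notin> A" "b \<notin> A" using B AB T(1) pos by fastforce+
    then have "A \<subseteq> ?N" using AB T(1) by blast
    then show ?thesis using AB top by (intro splitsI[of A "insert M B"]) auto
  qed
  \<comment> \<open>Because of \<open>p\<close>, the lowest and the leftmost point are the same with and without \<open>M\<close>.\<close>
  obtain p where p: "p \<in> ?N" using ne by blast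
  have eq: "insert M (?N \<union> {a, b}) = P \<union> {a, b}"
     "insert M (?N \<union> {a}) = P \<union> {a}" "insert M (?N \<union> {b}) = P \<union> {b}" using M by auto
  have min: "\<not> splits X Y (?N \<union> {a, b} - {m})"
    if m: "m \<in> ?N \<union> {a, b}" and nsp: "\<not> splits X Y (P \<union> {a, b} - {m})" for m
  proof
    assume sp: "splits X Y (?N \<union> {a, b} - {m})"
    have "splits X Y (insert M (?N \<union> {a, b} - {m}))"
      by (rule up[OF _ _ sp]) (use m ni in auto)
    moreover have "insert M (?N \<union> {a, b} - {m}) = P \<union> {a, b} - {m}" using m M ni by auto
    ultimately show False using nsp by simp
  qed
  have up1: "splits X Y (?N \<union> {a, b}) \<Longrightarrow> splits X Y (P \<union> {a, b})"
    using up[of "?N \<union> {a, b}"] unfolding eq by blast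
  have up2: "splits X Y (?N \<union> {b}) \<Longrightarrow> splits X Y (P \<union> {b})"
    using up[of "?N \<union> {b}"] unfolding eq by blast
  have up3: "splits X Y (?N \<union> {a}) \<Longrightarrow> splits X Y (P \<union> {a})"
    using up[of "?N \<union> {a}"] unfolding eq by blast
  have sub: "?N \<subseteq> P" "?N \<union> {a} \<subseteq> P \<union> {a}" "?N \<union> {b} \<subseteq> P \<union> {b}" by auto
  show ?thesis
    unfolding tight_def
  proof (intro conjI ballI impI)
    show "avoids_132 X Y ?N"
      using g avoids_132_mono[OF _ sub(1)] unfolding tight_def by blast
    show "\<not> splits X Y (?N \<union> {a, b})"
      using g up1 unfolding tight_def by blast
    show "\<not> splits X Y (?N \<union> {b}) \<or> avoids_132 X Y (?N \<union> {a})"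
      using g up2 avoids_132_mono[OF _ sub(2)] unfolding tight_def by blast
    show "\<not> splits X Y (?N \<union> {a}) \<or> avoids_132 X Y (?N \<union> {b})"
      using g up3 avoids_132_mono[OF _ sub(3)] unfolding tight_def by blast
  next
    fix m assume m: "m \<in> ?N \<union> {a, b}" "\<forall>v\<in>?N \<union> {a, b}. Y m \<le> Y v"
    then have "Y m \<le> Y p" "Y p < Y M" "\<forall>v\<in>P \<union> {a, b} - {M}. Y m \<le> Y v"
      using top[OF p] p by auto
    then have "\<forall>v\<in>P \<union> {a, b}. Y m \<le> Y v" by (metis Diff_iff less_imp_le order_trans singletonD)
    then show "\<not> splits X Y (?N \<union> {a, b} - {m})" using g m(1) min unfolding tight_def by blast
  next
    fix m assume m: "m \<in> ?N \<union> {a, b}" "\<forall>v\<in>?N \<union> {a, b}. X m \<le> X v"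
    then have "X m \<le> X p" "X p < X M" "\<forall>v\<in>P \<union> {a, b} - {M}. X m \<le> X v"
      using top[OF p] p by auto
    then have "\<forall>v\<in>P \<union> {a, b}. X m \<le> X v" by (metis Diff_iff less_imp_le order_trans singletonD)
    then show "\<not> splits X Y (?N \<union> {a, b} - {m})" using g m(1) min unfolding tight_def by blast
  qed
qed

text \<open>
  When both \<open>a\<close> and \<open>b\<close> form inversions with \<open>P\<close>, let \<open>M\<close> be the highest point of \<open>P\<close>, and \<open>L\<close> and \<open>R\<close>
  the points of \<open>P\<close> to its left and right. The cases below are: \<open>R\<close> is empty, and \<open>M\<close> can be removed
  by induction together with its two inversions with \<open>a\<close> and \<open>b\<close>; \<open>R\<close> has one point; \<open>L\<close> is empty;
  and the generic case \<open>|R| \<ge> 2\<close>, \<open>|L| \<ge> 1\<close>, where the \<open>(|L| + 1) |R|\<close> inversions between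
  \<open>insert M L\<close> and \<open>R\<close> almost suffice.
\<close>

lemma side_bound:
  assumes "side X Y P a b" "tight X Y P a b" "P \<noteq> {}"
  shows "2 * card P \<le> card (inv_pairs X Y (P \<union> {a, b})) + 1 \<and>
    ((\<exists>x\<in>P. X x < X b \<and> Y x < Y a) \<or> 2 * card P \<le> card (inv_pairs X Y (P \<union> {a, b})))"
  using assms
proof (induction "card P" arbitrary: P rule: less_induct)
  case less
  note s = less.prems(1) and g = less.prems(2) and ne = less.prems(3)
  have fin: "finite P" and inj: "inj_on X (P \<union> {a, b})" "inj_on Y (P \<union> {a, b})"
    and pos: "\<forall>p\<in>P. X p < X a \<and> Y p < Y b" "X b < X a" "Y a < Y b"
    using s unfolding side_def by auto
  have ni: "a \<notin> P" "b \<notin> P" "a \<noteq> b" using side_notin[OF s] by auto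
  have Yne: "Y p \<noteq> Y a" "X p \<noteq> X b" if "p \<in> P" for p
    using inj that ni by (auto simp: inj_on_def)
  have av: "avoids_132 X Y P" using g unfolding tight_def by blast
  note count = inv_pairs_side[OF s]
  show ?case
  proof (cases "(\<forall>p\<in>P. X p < X b) \<or> (\<forall>p\<in>P. Y p < Y a)")
    case True
    then show ?thesis
    proof
      assume "\<forall>p\<in>P. X p < X b"
      then show ?thesis using side_bound_unattached[OF s g ne] by blast
    next
      assume "\<forall>p\<in>P. Y p < Y a"
      then show ?thesis
        using side_bound_unattached[OF side_swap[OF s] tight_swap[OF g] ne]
        by (auto simp: inv_pairs_swap insert_commute)
    qed
  next
    case False
    then obtain p1 p2 where p1: "p1 \<in> P" "X b < X p1" and p2: "p2 \<in> P" "Y a < Y p2"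
      using Yne by (meson linorder_neqE)
    have "Max (Y ` P) \<in> Y ` P" using fin ne by (intro Max_in) auto
    then obtain M where M0: "M \<in> P" "Y M = Max (Y ` P)" by auto
    then have M: "M \<in> P" "\<And>p. p \<in> P \<Longrightarrow> Y p \<le> Y M" using fin by auto
    have Ma: "Y a < Y M" using M(2)[OF p2(1)] p2(2) by linarith
    define L where "L = {p\<in>P. X p < X M}"
    define R where "R = {p\<in>P. X M < X p}"
    have Mlt: "Y p < Y M" if "p \<in> P" "p \<noteq> M" for p
      using M that inj(2) by (metis UnCI inj_on_contraD order_le_less)
    have PLR: "P = insert M L \<union> R" and LRd: "insert M L \<inter> R = {}" and MnotL: "M \<notin> L"
      using M(1) inj(1) unfolding L_def R_def by (fastforce simp: inj_on_def)+
    have finLR: "finite L" "finite R" using fin unfolding L_def R_def by auto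
    have skew: "X u < X v \<and> Y v < Y u" if "u \<in> insert M L" "v \<in> R" for u v
    proof (cases "u = M")
      case True
      then show ?thesis using that Mlt unfolding R_def by auto
    next
      case False
      then have u: "u \<in> P" "X u < X M" "v \<in> P" "X M < X v" using that unfolding L_def R_def by auto
      then have "\<not> (Y u < Y v \<and> Y v < Y M)" using av M(1) unfolding avoids_132_def by blast
      moreover have "Y v < Y M" using Mlt u by auto
      moreover have "Y u \<noteq> Y v" using u inj_onD[OF inj(2), of u v] by auto
      ultimately show ?thesis using u by auto
    qed
    have cP: "card P = card L + 1 + card R"
      using card_Un_disjoint[OF _ finLR(2) LRd] PLR finLR MnotL by simp
    have cI: "card (inv_pairs X Y (insert M L)) + card (inv_pairs X Y R) + (card L + 1) * card R
        \<le> card (inv_pairs X Y P)"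
      using inv_pairs_skew[of "insert M L" R X Y, OF _ finLR(2) skew] unfolding PLR
      by (simp add: finLR MnotL)
    have dA: "card {p\<in>P. Y a < Y p} \<ge> 1" and dB: "card {p\<in>P. X b < X p} \<ge> 1"
      using p1 p2 fin by (auto simp: Suc_le_eq card_gt_0_iff)
    consider (corner) "R = {}" | (low) w where "R = {w}" | (high) "R \<noteq> {}" "L = {}"
      | (big) "card R \<ge> 2" "card L \<ge> 1"
    proof -
      have R0: "R = {} \<longleftrightarrow> card R = 0" and L0: "L = {} \<longleftrightarrow> card L = 0" using finLR by auto
      show thesis
      proof (cases "card R = 0 \<or> card R = 1")
        case True
        then show thesis using that(1,2) R0 card_1_singletonE by metis
      next
        case False
        then have "card R \<ge> 2" by linarith
        then show thesis using that(3,4) R0 L0 by (cases "card L = 0") (simp_all add: Suc_le_eq)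
      qed
    qed
    then show ?thesis
    proof cases
      case corner
      \<comment> \<open>\<open>M\<close> is also the last point of \<open>P\<close>, hence forms inversions with both \<open>a\<close> and \<open>b\<close>.\<close>
      have top: "X p < X M \<and> Y p < Y M" if "p \<in> P - {M}" for p
      proof -
        have p: "p \<in> P" "p \<noteq> M" using that by auto
        then have "p \<in> L" using PLR corner by blast
        then show ?thesis using Mlt[OF p] unfolding L_def by blast
      qed
      have Mb: "X b < X M" using top p1 by fastforce
      show ?thesis
      proof (cases "P - {M} = {}")
        case True
        then have "P = {M}" using M(1) by auto
        then show ?thesis using count dA dB by simp
      next
        case False
        let ?N = "P - {M}"
        have sN: "side X Y ?N a b" using side_subset[OF s] by blast
        have IH: "2 * card ?N \<le> card (inv_pairs X Y (?N \<union> {a, b})) + 1 \<and>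
            ((\<exists>x\<in>?N. X x < X b \<and> Y x < Y a) \<or> 2 * card ?N \<le> card (inv_pairs X Y (?N \<union> {a, b})))"
          using less.hyps[of ?N] sN tight_remove_corner[OF s g M(1) top False] False
            card_Diff1_less[OF fin M(1)] by blast
        have "{p\<in>P. Y a < Y p} = insert M {p\<in>?N. Y a < Y p}"
          "{p\<in>P. X b < X p} = insert M {p\<in>?N. X b < X p}" using M(1) Ma Mb by auto
        then have "card {p\<in>P. Y a < Y p} = card {p\<in>?N. Y a < Y p} + 1"
          "card {p\<in>P. X b < X p} = card {p\<in>?N. X b < X p} + 1" using fin by auto
        moreover have "card (inv_pairs X Y ?N) \<le> card (inv_pairs X Y P)"
          using inv_pairs_mono[OF _ fin] by blast
        ultimately have "card (inv_pairs X Y (?N \<union> {a, b})) + 2 \<le> card (inv_pairs X Y (P \<union> {a, b}))"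
          unfolding count inv_pairs_side[OF sN] by linarith
        moreover have "card P = card ?N + 1" using card_Suc_Diff1[OF fin M(1)] by linarith
        ultimately show ?thesis using IH by auto
      qed
    next
      case (low w)
      \<comment> \<open>\<open>w\<close> is the last and lowest point of \<open>P\<close>. If \<open>a\<close> is not below it, \<open>w\<close> is the lowest point
        of \<open>P \<union> {a, b}\<close>, and its removal leaves a set that does not split.\<close>
      let ?N = "insert M L"
      have w: "w \<in> P" "\<And>p. p \<in> P \<Longrightarrow> Y w \<le> Y p" "\<And>p. p \<in> P \<Longrightarrow> X p \<le> X w" "w \<notin> ?N"
        using PLR low LRd skew[of _ w] by (auto intro: less_imp_le)
      have wb: "X b < X w" using w(3)[OF p1(1)] p1(2) by linarith
      show ?thesis
      proof (cases "Y a < Y w")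
        case True
        then have "{p\<in>P. Y a < Y p} = P" using w(2) by force
        then show ?thesis using count dB cI cP low by simp
      next
        case False
        then have wa: "Y w < Y a" using Yne[OF w(1)] by auto
        have "\<forall>v\<in>P \<union> {a, b}. Y w \<le> Y v" using w(2) wa pos by auto
        then have "\<not> splits X Y (P \<union> {a, b} - {w})" using g w(1) unfolding tight_def by blast
        moreover have "P \<union> {a, b} - {w} = ?N \<union> {a, b}" using PLR low w(4) ni w(1) by auto
        ultimately have nsN: "\<not> splits X Y (?N \<union> {a, b})" by simp
        have NP: "?N \<subseteq> P" using PLR by auto
        have "card ?N \<le> card (inv_pairs X Y ?N) + card {p\<in>?N. Y a < Y p} + card {p\<in>?N. X b < X p}"
          by (rule attached_count[OF side_subset[OF s NP] avoids_132_mono[OF av NP] nsN])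
        moreover have "card {p\<in>?N. Y a < Y p} \<le> card {p\<in>P. Y a < Y p}"
          using NP fin by (intro card_mono) auto
        moreover have "{p\<in>P. X b < X p} = insert w {p\<in>?N. X b < X p}"
          using PLR low wb by auto
        then have "card {p\<in>P. X b < X p} = card {p\<in>?N. X b < X p} + 1" using finLR w(4) by simp
        ultimately show ?thesis using count cI cP low MnotL finLR by simp
      qed
    next
      case high
      \<comment> \<open>\<open>M\<close> is the first and highest point of \<open>P\<close>. If \<open>b\<close> is not to its left, \<open>M\<close> is the leftmost
        point of \<open>P \<union> {a, b}\<close>, and its removal leaves a set that does not split.\<close>
      have PM: "P = insert M R" "M \<notin> R" using PLR LRd high by auto
      have Mx: "\<And>p. p \<in> P \<Longrightarrow> X M \<le> X p" using PM skew[of M] by (auto intro: less_imp_le)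
      show ?thesis
      proof (cases "X b < X M")
        case True
        then have "{p\<in>P. X b < X p} = P" using Mx by force
        then show ?thesis using count dA cI cP high by simp
      next
        case False
        then have Mb: "X M < X b" using Yne[OF M(1)] by auto
        have "\<forall>v\<in>P \<union> {a, b}. X M \<le> X v" using Mx Mb pos by auto
        then have "\<not> splits X Y (P \<union> {a, b} - {M})" using g M(1) unfolding tight_def by blast
        moreover have "P \<union> {a, b} - {M} = R \<union> {a, b}" using PM ni M(1) by auto
        ultimately have nsN: "\<not> splits X Y (R \<union> {a, b})" by simp
        have NP: "R \<subseteq> P" using PM by auto
        have "card R \<le> card (inv_pairs X Y R) + card {p\<in>R. Y a < Y p} + card {p\<in>R. X b < X p}"
          by (rule attached_count[OF side_subset[OF s NP] avoids_132_mono[OF av NP] nsN])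
        moreover have "card {p\<in>R. X b < X p} \<le> card {p\<in>P. X b < X p}"
          using NP fin by (intro card_mono) auto
        moreover have "{p\<in>P. Y a < Y p} = insert M {p\<in>R. Y a < Y p}"
          using PM Ma by auto
        then have "card {p\<in>P. Y a < Y p} = card {p\<in>R. Y a < Y p} + 1" using finLR PM by simp
        ultimately show ?thesis using count cI cP high by simp
      qed
    next
      case big
      \<comment> \<open>With \<open>l = |L| - 1\<close> and \<open>r = |R| - 2\<close>, the estimate \<open>base\<close> says that \<open>(l + 2)(r + 2)\<close> is at
        least \<open>2(l + r + 4) - 4\<close>.\<close>
      obtain l r where lr: "card L = l + 1" "card R = r + 2"
        using big by (metis add.commute le_Suc_ex)
      have base: "2 * card P \<le> card (inv_pairs X Y P) + 4"
        using cI unfolding cP lr by (simp add: algebra_simps)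
      have "2 * card P \<le> card (inv_pairs X Y (P \<union> {a, b}))"
        if nx: "\<not> (\<exists>x\<in>P. X x < X b \<and> Y x < Y a)"
      proof -
        \<comment> \<open>Every point of \<open>P\<close> forms an inversion with \<open>a\<close> or \<open>b\<close>, and \<open>|P| \<ge> 4\<close>.\<close>
        have "P \<subseteq> {p\<in>P. Y a < Y p} \<union> {p\<in>P. X b < X p}" using nx Yne by force
        then have "card P \<le> card ({p\<in>P. Y a < Y p} \<union> {p\<in>P. X b < X p})"
          using fin by (intro card_mono) auto
        also have "\<dots> \<le> card {p\<in>P. Y a < Y p} + card {p\<in>P. X b < X p}" by (rule card_Un_le)
        finally show ?thesis using base count cP lr by linarith
      qed
      moreover have "2 * card P \<le> card (inv_pairs X Y (P \<union> {a, b})) + 1"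
        using base count dA dB by linarith
      ultimately show ?thesis by blast
    qed
  qed
qed

section \<open>Cuts that are crossed once in each direction\<close>

text \<open>
  All of \<open>Q\<close> lies to the upper right of all of \<open>P\<close>, and only \<open>b\<close> and \<open>a\<close> are on the upper left and
  lower right of the cut.
\<close>

definition cut :: "('v \<Rightarrow> int) \<Rightarrow> ('v \<Rightarrow> int) \<Rightarrow> 'v set \<Rightarrow> 'v set \<Rightarrow> 'v \<Rightarrow> 'v \<Rightarrow> bool" where
  "cut X Y P Q a b \<longleftrightarrow> X b < X a \<and> Y a < Y b \<and>
     (\<forall>p\<in>P. X p < X a \<and> Y p < Y b) \<and> (\<forall>q\<in>Q. X b < X q \<and> Y a < Y q) \<and>
     (\<forall>p\<in>P. \<forall>q\<in>Q. X p < X q \<and> Y p < Y q)"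

text \<open>
  The diagram is indecomposable, but not almost decomposable: it does not split even after removal
  of a point that is extremal in one of the four directions.
\<close>

definition robust :: "('v \<Rightarrow> int) \<Rightarrow> ('v \<Rightarrow> int) \<Rightarrow> 'v set \<Rightarrow> bool" where
  "robust X Y V \<longleftrightarrow> \<not> splits X Y V \<and>
     (\<forall>m\<in>V. (\<forall>v\<in>V. X m \<le> X v) \<or> (\<forall>v\<in>V. X v \<le> X m) \<or>
       (\<forall>v\<in>V. Y m \<le> Y v) \<or> (\<forall>v\<in>V. Y v \<le> Y m) \<longrightarrow> \<not> splits X Y (V - {m}))"

lemma cut_uminus: "cut X Y P Q a b \<Longrightarrow> cut (\<lambda>v. - X v) (\<lambda>v. - Y v) Q P b a"
  unfolding cut_def by auto

lemma robust_uminus: "robust X Y V \<Longrightarrow> robust (\<lambda>v. - X v) (\<lambda>v. - Y v) V"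
  unfolding robust_def splits_uminus neg_le_iff_le by blast

text \<open>
  As \<open>a\<close> and \<open>b\<close> form an inversion, and no point of \<open>P\<close> is to the upper right of either, the upper
  right part of a splitting contains whichever of \<open>a\<close> and \<open>b\<close> is present. So \<open>Q\<close> can join it.
\<close>

lemma splits_beyond_cut:
  assumes c: "cut X Y P Q a b" and T: "T \<subseteq> P \<union> {a, b}" "T \<inter> {a, b} \<noteq> {}" "splits X Y T"
  shows "splits X Y (T \<union> Q)"
proof -
  have pos: "X b < X a" "Y a < Y b" "\<And>p. p \<in> P \<Longrightarrow> X p < X a \<and> Y p < Y b"
    using c unfolding cut_def by auto
  obtain A B where AB: "A \<noteq> {}" "B \<noteq> {}" "A \<union> B = T"
    and lt: "\<And>u v. u \<in> A \<Longrightarrow> v \<in> B \<Longrightarrow> X u < X v \<and> Y u < Y v"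
    using T(3) unfolding splits_def by blast
  obtain v where v: "v \<in> B" using AB by blast
  then have vT: "v \<in> P \<or> v = a \<or> v = b" using AB T(1) by blast
  have "a \<notin> A" using lt[OF _ v, of a] vT pos(1,2) pos(3)[of v] by auto
  moreover have "b \<notin> A" using lt[OF _ v, of b] vT pos(1,2) pos(3)[of v] by auto
  ultimately have AP: "A \<subseteq> P" using AB T(1) by blast
  have PQ: "\<And>p q. p \<in> P \<Longrightarrow> q \<in> Q \<Longrightarrow> X p < X q \<and> Y p < Y q"
    using c unfolding cut_def by blast
  show ?thesis
  proof (rule splitsI[of A "B \<union> Q"])
    show "A \<union> (B \<union> Q) = T \<union> Q" using AB(3) by blast
    show "X u < X v \<and> Y u < Y v" if "u \<in> A" "v \<in> B \<union> Q" for u v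
      using that lt PQ AP by blast
  qed (use AB in auto)
qed

lemma avoids_132_below:
  assumes "avoids_1324 X Y V" "S \<subseteq> V" "z \<in> V" "\<And>v. v \<in> S \<Longrightarrow> X v < X z \<and> Y v < Y z"
  shows "avoids_132 X Y S"
  unfolding avoids_132_def
proof (intro ballI impI)
  fix u v w assume "u \<in> S" "v \<in> S" "w \<in> S" "X u < X v" "X v < X w"
  then show "\<not> (Y u < Y w \<and> Y w < Y v)"
    using assms(1)[unfolded avoids_1324_def, rule_format, of u v w z] assms(2-4) by blast
qed

lemma side_of_cut:
  assumes c: "cut X Y P Q a b" and V: "V = P \<union> Q \<union> {a, b}" and fin: "finite V"
    and inj: "inj_on X V" "inj_on Y V"
  shows "side X Y P a b"
proof -
  have "P \<union> {a, b} \<subseteq> V" using V by blast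
  then have "inj_on X (P \<union> {a, b})" "inj_on Y (P \<union> {a, b})"
    using inj inj_on_subset by blast+
  then show ?thesis using c V fin unfolding side_def cut_def by simp
qed

lemma tight_of_cut:
  assumes c: "cut X Y P Q a b" and V: "V = P \<union> Q \<union> {a, b}"
    and r: "robust X Y V" and av: "avoids_1324 X Y V" and Q: "Q \<noteq> {}"
  shows "tight X Y P a b"
proof -
  have pos: "X b < X a" "Y a < Y b" "\<And>p. p \<in> P \<Longrightarrow> X p < X a \<and> Y p < Y b"
      "\<And>q. q \<in> Q \<Longrightarrow> X b < X q \<and> Y a < Y q"
      "\<And>p q. p \<in> P \<Longrightarrow> q \<in> Q \<Longrightarrow> X p < X q \<and> Y p < Y q"
    using c unfolding cut_def by blast+
  note ext = splits_beyond_cut[OF c]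
  have disj: "a \<notin> P" "b \<notin> P" "a \<notin> Q" "b \<notin> Q" "a \<noteq> b" "P \<inter> Q = {}"
    using pos by fastforce+
  show ?thesis
    unfolding tight_def
  proof (intro conjI ballI impI)
    obtain q where q: "q \<in> Q" using Q by blast
    show "avoids_132 X Y P"
      by (rule avoids_132_below[OF av, of _ q]) (use V q pos(5) in auto)
    show "\<not> splits X Y (P \<union> {a, b})"
    proof
      assume "splits X Y (P \<union> {a, b})"
      then have "splits X Y (P \<union> {a, b} \<union> Q)" by (intro ext) auto
      moreover have "P \<union> {a, b} \<union> Q = V" using V by blast
      ultimately show False using r unfolding robust_def by simp
    qed
    show "\<not> splits X Y (P \<union> {b}) \<or> avoids_132 X Y (P \<union> {a})"
    proof (cases "\<forall>v\<in>V. X v \<le> X a")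
      case True
      have "\<not> splits X Y (P \<union> {b})"
      proof
        assume "splits X Y (P \<union> {b})"
        then have "splits X Y (P \<union> {b} \<union> Q)" by (intro ext) auto
        moreover have "P \<union> {b} \<union> Q = V - {a}" using V disj by blast
        moreover have "a \<in> V" using V by blast
        ultimately show False using r True unfolding robust_def by simp
      qed
      then show ?thesis by blast
    next
      case False
      then obtain y where y: "y \<in> V" "X a < X y" by auto
      then have "y \<in> Q" using V pos(1) pos(3)[of y] by auto
      then have "avoids_132 X Y (P \<union> {a})"
        by (intro avoids_132_below[OF av, of _ y]) (use V y pos(4,5) in auto)
      then show ?thesis by blast
    qed
    show "\<not> splits X Y (P \<union> {a}) \<or> avoids_132 X Y (P \<union> {b})"
    proof (cases "\<forall>v\<in>V. Y v \<le> Y b")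
      case True
      have "\<not> splits X Y (P \<union> {a})"
      proof
        assume "splits X Y (P \<union> {a})"
        then have "splits X Y (P \<union> {a} \<union> Q)" by (intro ext) auto
        moreover have "P \<union> {a} \<union> Q = V - {b}" using V disj by blast
        moreover have "b \<in> V" using V by blast
        ultimately show False using r True unfolding robust_def by simp
      qed
      then show ?thesis by blast
    next
      case False
      then obtain y where y: "y \<in> V" "Y b < Y y" by auto
      then have "y \<in> Q" using V pos(2) pos(3)[of y] by auto
      then have "avoids_132 X Y (P \<union> {b})"
        by (intro avoids_132_below[OF av, of _ y]) (use V y pos(4,5) in auto)
      then show ?thesis by blast
    qed
  next
    fix m assume m: "m \<in> P \<union> {a, b}" "\<forall>v\<in>P \<union> {a, b}. Y m \<le> Y v"
    then have "Y m \<le> Y a" by blast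
    then have min: "\<forall>v\<in>V. Y m \<le> Y v" using m(2) V pos(4) by fastforce
    show "\<not> splits X Y (P \<union> {a, b} - {m})"
    proof
      assume "splits X Y (P \<union> {a, b} - {m})"
      then have "splits X Y (P \<union> {a, b} - {m} \<union> Q)" by (intro ext) (use disj in auto)
      moreover have "P \<union> {a, b} - {m} \<union> Q = V - {m}" using V disj m(1) by blast
      moreover have "m \<in> V" using V m(1) by blast
      ultimately show False using r min unfolding robust_def by simp
    qed
  next
    fix m assume m: "m \<in> P \<union> {a, b}" "\<forall>v\<in>P \<union> {a, b}. X m \<le> X v"
    then have "X m \<le> X b" by blast
    then have min: "\<forall>v\<in>V. X m \<le> X v" using m(2) V pos(4) by fastforce
    show "\<not> splits X Y (P \<union> {a, b} - {m})"
    proof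
      assume "splits X Y (P \<union> {a, b} - {m})"
      then have "splits X Y (P \<union> {a, b} - {m} \<union> Q)" by (intro ext) (use disj in auto)
      moreover have "P \<union> {a, b} - {m} \<union> Q = V - {m}" using V disj m(1) by blast
      moreover have "m \<in> V" using V m(1) by blast
      ultimately show False using r min unfolding robust_def by simp
    qed
  qed
qed

lemma cut_bound:
  assumes c: "cut X Y P Q a b" and V: "V = P \<union> Q \<union> {a, b}" and fin: "finite V"
    and inj: "inj_on X V" "inj_on Y V"
    and r: "robust X Y V" and av: "avoids_1324 X Y V" and ne: "P \<noteq> {}" "Q \<noteq> {}"
  shows "2 * card V \<le> card (inv_pairs X Y V) + 6"
proof -
  let ?X = "\<lambda>v. - X v" and ?Y = "\<lambda>v. - Y v"
  let ?L = "inv_pairs X Y (P \<union> {a, b})" and ?R = "inv_pairs X Y (Q \<union> {a, b})"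
  have V': "V = Q \<union> P \<union> {b, a}" using V by blast
  have inj': "inj_on ?X V" "inj_on ?Y V" using inj by (auto simp: inj_on_def)
  note c' = cut_uminus[OF c]
  have sP: "side X Y P a b" by (rule side_of_cut[OF c V fin inj])
  have sQ: "side ?X ?Y Q b a" by (rule side_of_cut[OF c' V' fin inj'])
  have gP: "tight X Y P a b" by (rule tight_of_cut[OF c V r av ne(2)])
  have gQ: "tight ?X ?Y Q b a"
    by (rule tight_of_cut[OF c' V' robust_uminus[OF r] avoids_1324_uminus[OF av] ne(1)])
  have pos: "X b < X a" "Y a < Y b" and PQ: "P \<inter> Q = {}"
    using c unfolding cut_def by fastforce+
  have bP: "2 * card P \<le> card ?L + 1"
    and xP: "(\<exists>x\<in>P. X x < X b \<and> Y x < Y a) \<or> 2 * card P \<le> card ?L"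
    using side_bound[OF sP gP ne(1)] by blast+
  have eR: "card (inv_pairs ?X ?Y (Q \<union> {b, a})) = card ?R"
    by (simp add: inv_pairs_uminus insert_commute)
  have bQ: "2 * card Q \<le> card ?R + 1"
    and xQ: "(\<exists>y\<in>Q. ?X y < ?X a \<and> ?Y y < ?Y b) \<or> 2 * card Q \<le> card ?R"
    using side_bound[OF sQ gQ ne(2)] unfolding eR by blast+
  have "2 * card P \<le> card ?L \<or> 2 * card Q \<le> card ?R"
  proof (rule ccontr)
    assume "\<not> ?thesis"
    then obtain x y where x: "x \<in> P" "X x < X b" "Y x < Y a" and y: "y \<in> Q" "X a < X y" "Y b < Y y"
      using xP xQ by auto
    then show False
      using av[unfolded avoids_1324_def, rule_format, of x b a y] pos V by blast
  qed
  then have "2 * card P + 2 * card Q \<le> card ?L + card ?R + 1" using bP bQ by linarith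
  moreover have "card ?L + card ?R \<le> card (inv_pairs X Y V) + 1"
  proof -
    have finLR: "finite ?L" "finite ?R" using fin V by (auto intro!: finite_inv_pairs)
    have "?L \<inter> ?R \<subseteq> {(b, a)}"
      using PQ pos unfolding inv_pairs_def by auto
    then have "card (?L \<inter> ?R) \<le> 1" using card_mono[of "{(b, a)}" "?L \<inter> ?R"] by simp
    moreover have "card (?L \<union> ?R) \<le> card (inv_pairs X Y V)"
      by (rule card_mono[OF finite_inv_pairs[OF fin]]) (auto simp: inv_pairs_def V)
    ultimately show ?thesis using card_Un_Int[OF finLR] by linarith
  qed
  moreover have "card V = card P + card Q + 2"
  proof -
    have "a \<notin> P \<union> Q" "b \<notin> P \<union> Q" "a \<noteq> b" using side_notin[OF sP] side_notin[OF sQ] by auto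
    moreover have "finite P" "finite Q" using fin V by auto
    ultimately show ?thesis unfolding V using PQ by (simp add: card_Un_disjoint)
  qed
  ultimately show ?thesis by linarith
qed

section \<open>Permutations in one-line notation\<close>

lemma standardize_append:
  assumes "\<And>y z. y \<in> set ys \<Longrightarrow> z \<in> set zs \<Longrightarrow> y < z" and "distinct ys"
  shows "standardize (ys @ zs) = direct_sum (standardize ys) (standardize zs)"
proof -
  have len: "length (standardize ys) = length ys" by (simp add: standardize_def)
  have 1: "{u \<in> set (ys @ zs). u \<le> y} = {u \<in> set ys. u \<le> y}" if "y \<in> set ys" for y
    using assms(1)[OF that] by fastforce
  have 2: "card {u \<in> set (ys @ zs). u \<le> z} = length ys + card {u \<in> set zs. u \<le> z}"
    if "z \<in> set zs" for z
  proof -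
    have "{u \<in> set (ys @ zs). u \<le> z} = set ys \<union> {u \<in> set zs. u \<le> z}"
      using assms(1)[OF _ that] by (auto intro: less_imp_le)
    moreover have "set ys \<inter> {u \<in> set zs. u \<le> z} = {}" using assms(1) by fastforce
    ultimately show ?thesis using assms(2) by (simp add: card_Un_disjoint distinct_card)
  qed
  have "map (\<lambda>x. card {u \<in> set (ys @ zs). u \<le> x}) ys = standardize ys"
    unfolding standardize_def using 1 by (intro map_cong) auto
  moreover have "map (\<lambda>x. card {u \<in> set (ys @ zs). u \<le> x}) zs = map (\<lambda>x. length ys + x) (standardize zs)"
    unfolding standardize_def map_map o_def by (intro map_cong[OF refl] 2)
  ultimately show ?thesis
    unfolding direct_sum_def len by (simp add: standardize_def[of "ys @ zs"])
qed

lemma decomposable_standardize_append: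
  assumes "distinct (ys @ zs)" "ys \<noteq> []" "zs \<noteq> []"
    and "\<And>y z. y \<in> set ys \<Longrightarrow> z \<in> set zs \<Longrightarrow> y < z"
  shows "decomposable (standardize (ys @ zs))"
  unfolding decomposable_def
proof (intro exI conjI)
  show "standardize (ys @ zs) = direct_sum (standardize ys) (standardize zs)"
    using standardize_append[OF assms(4)] assms(1) by simp
  show "standardize ys \<in> perms (length ys)" "standardize zs \<in> perms (length zs)"
    using assms(1) standardize_in_perms[of ys] standardize_in_perms[of zs] by simp_all
qed (use assms in auto)

text \<open>
  Deleting a value that does not occur leaves the list unchanged, so this covers the decomposability
  of the permutation itself as well.
\<close>

lemma decomposable_if_splits:
  assumes dist: "distinct \<pi>"
    and sp: "splits int (\<lambda>i. int (\<pi> ! i)) {i. i < length \<pi> \<and> \<pi> ! i \<noteq> v}"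
  shows "decomposable (standardize (removeAll v \<pi>))"
proof -
  obtain A B where AB: "A \<noteq> {}" "B \<noteq> {}" "A \<union> B = {i. i < length \<pi> \<and> \<pi> ! i \<noteq> v}"
    and lt: "\<And>i j. i \<in> A \<Longrightarrow> j \<in> B \<Longrightarrow> i < j \<and> \<pi> ! i < \<pi> ! j"
    using sp unfolding splits_def by force
  have "finite (A \<union> B)" unfolding AB(3) by simp
  then have fin: "finite A" by simp
  define t where "t = Suc (Max A)"
  have At: "i < t" if "i \<in> A" for i
    using Max_ge[OF fin that] unfolding t_def by simp
  have Bt: "t \<le> j" if "j \<in> B" for j
    using lt[OF Max_in[OF fin AB(1)] that] unfolding t_def by simp
  define ys where "ys = removeAll v (take t \<pi>)"
  define zs where "zs = removeAll v (drop t \<pi>)"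
  have split: "removeAll v \<pi> = ys @ zs"
    unfolding ys_def zs_def by (metis append_take_drop_id removeAll_append)
  have ys: "set ys = (!) \<pi> ` A"
  proof (intro set_eqI iffI)
    fix y assume "y \<in> set ys"
    then obtain i where "i < length \<pi>" "i < t" "y = \<pi> ! i" "y \<noteq> v"
      unfolding ys_def by (auto simp: in_set_conv_nth)
    then show "y \<in> (!) \<pi> ` A" using AB(3) Bt[of i] by auto
  next
    fix y assume "y \<in> (!) \<pi> ` A"
    then obtain i where i: "i \<in> A" "y = \<pi> ! i" by blast
    then have "i < length \<pi>" "y \<noteq> v" using AB(3) by auto
    then show "y \<in> set ys" unfolding ys_def using i At[OF i(1)] by (auto simp: in_set_conv_nth)
  qed
  have zs: "set zs = (!) \<pi> ` B"
  proof (intro set_eqI iffI)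
    fix y assume "y \<in> set zs"
    then obtain i where i: "i < length \<pi> - t" "y = drop t \<pi> ! i" "y \<noteq> v"
      unfolding zs_def by (auto simp: in_set_conv_nth)
    then have "t + i \<in> A \<union> B" "y = \<pi> ! (t + i)" unfolding AB(3) by auto
    then show "y \<in> (!) \<pi> ` B" using At[of "t + i"] by auto
  next
    fix y assume "y \<in> (!) \<pi> ` B"
    then obtain i where i: "i \<in> B" "y = \<pi> ! i" by blast
    then have "i < length \<pi>" "y \<noteq> v" using AB(3) by auto
    moreover have "drop t \<pi> ! (i - t) = y" "i - t < length (drop t \<pi>)"
      using i Bt[OF i(1)] calculation by auto
    ultimately show "y \<in> set zs" unfolding zs_def using nth_mem[of "i - t" "drop t \<pi>"] by simp
  qed
  show ?thesis
    unfolding split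
  proof (rule decomposable_standardize_append)
    show "distinct (ys @ zs)" unfolding split[symmetric] using dist by (simp add: distinct_removeAll)
    show "ys \<noteq> []" "zs \<noteq> []" using ys zs AB(1,2) by auto
    show "y < z" if "y \<in> set ys" "z \<in> set zs" for y z
      using that lt unfolding ys zs by blast
  qed
qed

text \<open>The offset \<open>s\<close> serves the induction; only \<open>s = 0\<close> is used.\<close>

lemma subseq_map_nth_drop:
  assumes "sorted_wrt (<) is" "\<And>i. i \<in> set is \<Longrightarrow> s \<le> i \<and> i < length xs"
  shows "subseq (map ((!) xs) is) (drop s xs)"
  using assms
proof (induction "is" arbitrary: s)
  case (Cons i "is")
  have i: "s \<le> i" "i < length xs" using Cons.prems(2)[of i] by auto
  have "subseq (map ((!) xs) is) (drop (Suc i) xs)"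
    using Cons.prems by (intro Cons.IH) (auto simp: Suc_le_eq)
  then have "subseq (map ((!) xs) (i # is)) (drop i xs)"
    using i by (simp add: Cons_nth_drop_Suc[symmetric])
  moreover have "suffix (drop i xs) (drop s xs)"
    using i(1) by (metis drop_drop le_add_diff_inverse2 suffix_drop)
  ultimately show ?case using subseq_order.trans suffix_imp_subseq by blast
qed simp

lemma avoids_1324_if_avoids:
  assumes "avoids \<pi> [1, 3, 2, 4]"
  shows "avoids_1324 int (\<lambda>i. int (\<pi> ! i)) {..<length \<pi>}"
  unfolding avoids_1324_def
proof (intro ballI impI notI)
  fix u v w z
  assume in_range: "u \<in> {..<length \<pi>}" "v \<in> {..<length \<pi>}" "w \<in> {..<length \<pi>}" "z \<in> {..<length \<pi>}"
    and x: "int u < int v" "int v < int w" "int w < int z"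
    and y: "int (\<pi> ! u) < int (\<pi> ! w) \<and> int (\<pi> ! w) < int (\<pi> ! v) \<and> int (\<pi> ! v) < int (\<pi> ! z)"
  have "subseq (map ((!) \<pi>) [u, v, w, z]) (drop 0 \<pi>)"
    by (rule subseq_map_nth_drop) (use in_range x in auto)
  then have "subseq [\<pi> ! u, \<pi> ! v, \<pi> ! w, \<pi> ! z] \<pi>" by simp
  moreover have "order_isomorphic [\<pi> ! u, \<pi> ! v, \<pi> ! w, \<pi> ! z] [1, 3, 2, 4]"
    using y unfolding order_isomorphic_def by (simp add: All_less_Suc)
  ultimately show False using assms unfolding avoids_def by blast
qed

text \<open>
  Both sides are sums over positions. An entry \<open>\<pi> ! i\<close> crosses \<open>\<pi> ! i - i - 1\<close> cuts from the left
  (none if this is negative), positions being counted from \<open>0\<close>. At most \<open>i\<close> of the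
  \<open>\<pi> ! i - 1\<close> smaller values occur before it, so at least as many follow it and form inversions.
\<close>

lemma crossings_le_inversions:
  assumes "\<pi> \<in> perms n"
  shows "(\<Sum>j\<in>{1..<n}. card {i. i < j \<and> j < \<pi> ! i}) \<le> card (inversions \<pi>)"
proof -
  have len: "length \<pi> = n" and set: "set \<pi> = {1..n}"
    using assms by (auto simp: permutations_of_set_def length_finite_permutations_of_set)
  define G where "G i = {k. i < k \<and> k < n \<and> \<pi> ! k < \<pi> ! i}" for i
  have finG: "finite (G i)" for i unfolding G_def by simp
  \<comment> \<open>Count the pairs of an entry and a cut that it crosses by cuts and by entries.\<close>
  let ?C = "SIGMA j:{1..<n}. {i. i < j \<and> j < \<pi> ! i}"
  let ?D = "SIGMA i:{..<n}. {j\<in>{1..<n}. i < j \<and> j < \<pi> ! i}"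
  have "(\<Sum>j\<in>{1..<n}. card {i. i < j \<and> j < \<pi> ! i}) = card ?C" by simp
  also have "?C = prod.swap ` ?D" by (auto simp: image_iff)
  also have "card (prod.swap ` ?D) = card ?D" by (simp add: card_image)
  also have "\<dots> = (\<Sum>i<n. card {j\<in>{1..<n}. i < j \<and> j < \<pi> ! i})" by simp
  also have "\<dots> \<le> (\<Sum>i<n. card (G i))"
  proof (rule sum_mono)
    fix i assume "i \<in> {..<n}"
    then have i: "i < n" by simp
    have "card {j\<in>{1..<n}. i < j \<and> j < \<pi> ! i} \<le> card {Suc i..<\<pi> ! i}"
      by (intro card_mono) auto
    then have 1: "card {j\<in>{1..<n}. i < j \<and> j < \<pi> ! i} \<le> \<pi> ! i - Suc i" by simp
    have "{1..<\<pi> ! i} \<subseteq> (!) \<pi> ` ({..<i} \<union> G i)"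
    proof
      fix y assume y: "y \<in> {1..<\<pi> ! i}"
      have "\<pi> ! i \<in> set \<pi>" using i len by simp
      then have "y \<in> set \<pi>" using y set by auto
      then obtain k where k: "k < n" "y = \<pi> ! k" using len by (auto simp: in_set_conv_nth)
      then have "k \<noteq> i" using y by auto
      then show "y \<in> (!) \<pi> ` ({..<i} \<union> G i)" using k y unfolding G_def by auto
    qed
    then have "card {1..<\<pi> ! i} \<le> card ({..<i} \<union> G i)"
      using finG by (intro surj_card_le) auto
    also have "\<dots> \<le> i + card (G i)" using card_Un_le[of "{..<i}" "G i"] by simp
    finally show "card {j\<in>{1..<n}. i < j \<and> j < \<pi> ! i} \<le> card (G i)" using 1 by simp
  qed
  also have "\<dots> = card (SIGMA i:{..<n}. G i)" using finG by simp
  also have "(SIGMA i:{..<n}. G i) = inversions \<pi>"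
    unfolding inversions_def G_def using len by auto
  finally show ?thesis .
qed

lemma card_crossings_eq:
  assumes "\<pi> \<in> perms n" "j \<le> n"
  shows "card {i. j \<le> i \<and> i < n \<and> \<pi> ! i \<le> j} = card {i. i < j \<and> j < \<pi> ! i}"
proof -
  have len: "length \<pi> = n" and dist: "distinct \<pi>" and set: "set \<pi> = {1..n}"
    using assms by (auto simp: permutations_of_set_def length_finite_permutations_of_set)
  let ?C = "{i. i < j \<and> j < \<pi> ! i}" and ?D = "{i. j \<le> i \<and> i < n \<and> \<pi> ! i \<le> j}"
    and ?S = "{i. i < j \<and> \<pi> ! i \<le> j}"
  have "(!) \<pi> ` (?S \<union> ?D) = {1..j}"
  proof (intro set_eqI iffI)
    fix y assume "y \<in> (!) \<pi> ` (?S \<union> ?D)"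
    then obtain i where "i \<in> ?S \<union> ?D" "y = \<pi> ! i" by blast
    then have "i < n" "\<pi> ! i \<le> j" "y = \<pi> ! i" using assms(2) by auto
    moreover have "\<pi> ! i \<in> set \<pi>" using calculation len by simp
    ultimately show "y \<in> {1..j}" using set by auto
  next
    fix y assume y: "y \<in> {1..j}"
    then have "y \<in> set \<pi>" using set assms(2) by auto
    then obtain i where "i < n" "y = \<pi> ! i" using len by (auto simp: in_set_conv_nth)
    then show "y \<in> (!) \<pi> ` (?S \<union> ?D)" using y by auto
  qed
  moreover have "inj_on ((!) \<pi>) (?S \<union> ?D)"
    using dist len assms(2) by (auto simp: inj_on_def nth_eq_iff_index_eq)
  ultimately have "card (?S \<union> ?D) = j" using card_image by fastforce
  moreover have "card (?S \<union> ?D) = card ?S + card ?D" by (intro card_Un_disjoint) auto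
  moreover have "card (?S \<union> ?C) = card ?S + card ?C" by (intro card_Un_disjoint) auto
  moreover have "?S \<union> ?C = {..<j}" by auto
  ultimately show ?thesis by simp
qed

lemma robust_if_not_almost_decomposable:
  assumes p: "\<pi> \<in> perms n" and "indecomposable \<pi>" "\<not> almost_decomposable \<pi>"
  shows "robust int (\<lambda>i. int (\<pi> ! i)) {..<n}"
proof -
  have len: "length \<pi> = n" and dist: "distinct \<pi>" and set: "set \<pi> = {1..n}"
    using p by (auto simp: permutations_of_set_def length_finite_permutations_of_set)
  let ?Y = "\<lambda>i. int (\<pi> ! i)"
  have rem: "\<not> splits int ?Y ({..<n} - {m})"
    if "m < n" "\<pi> ! m \<in> {1, n, hd \<pi>, last \<pi>}" for m
  proof
    assume "splits int ?Y ({..<n} - {m})"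
    moreover have "{..<n} - {m} = {i. i < length \<pi> \<and> \<pi> ! i \<noteq> \<pi> ! m}"
      using that(1) len dist by (auto simp: nth_eq_iff_index_eq)
    ultimately have "decomposable (remove_value \<pi> (\<pi> ! m))"
      unfolding remove_value_def using decomposable_if_splits[OF dist] by simp
    then show False
      using assms(2,3) that(2) len unfolding almost_decomposable_def by auto
  qed
  show ?thesis
    unfolding robust_def
  proof (intro conjI ballI impI)
    show "\<not> splits int ?Y {..<n}"
    proof
      assume "splits int ?Y {..<n}"
      moreover have "{..<n} = {i. i < length \<pi> \<and> \<pi> ! i \<noteq> 0}"
      proof -
        have "\<pi> ! i \<noteq> 0" if "i < n" for i using nth_mem[of i \<pi>] that len set by auto
        then show ?thesis using len by auto
      qed
      ultimately have "decomposable (standardize (removeAll 0 \<pi>))"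
        using decomposable_if_splits[OF dist] by simp
      moreover have "removeAll 0 \<pi> = \<pi>" using set by (intro removeAll_id) simp
      ultimately show False using standardize_perm[OF p] assms(2) by simp
    qed
  next
    fix m assume "m \<in> {..<n}"
      and ext: "(\<forall>v\<in>{..<n}. int m \<le> int v) \<or> (\<forall>v\<in>{..<n}. int v \<le> int m) \<or>
        (\<forall>v\<in>{..<n}. ?Y m \<le> ?Y v) \<or> (\<forall>v\<in>{..<n}. ?Y v \<le> ?Y m)"
    then have m: "m < n" by simp
    then have ne: "\<pi> \<noteq> []" using len by auto
    have pm: "\<pi> ! m \<in> {1..n}" using nth_mem[of m \<pi>] m len set by simp
    from ext have "\<pi> ! m \<in> {1, n, hd \<pi>, last \<pi>}"
    proof (elim disjE)
      assume *: "\<forall>v\<in>{..<n}. int m \<le> int v"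
      have "int m \<le> int 0" by (rule bspec[OF *]) (use m in simp)
      then have "m = 0" by simp
      then show ?thesis using ne by (simp add: hd_conv_nth)
    next
      assume *: "\<forall>v\<in>{..<n}. int v \<le> int m"
      have "int (n - 1) \<le> int m" by (rule bspec[OF *]) (use m in simp)
      then have "m = n - 1" using m by linarith
      then show ?thesis using ne len by (simp add: last_conv_nth)
    next
      assume *: "\<forall>v\<in>{..<n}. ?Y m \<le> ?Y v"
      have "1 \<in> set \<pi>" using m set by auto
      then obtain i where "i < n" "\<pi> ! i = 1" using len by (auto simp: in_set_conv_nth)
      then have "\<pi> ! m = 1" using bspec[OF *, of i] pm by simp
      then show ?thesis by simp
    next
      assume *: "\<forall>v\<in>{..<n}. ?Y v \<le> ?Y m"
      have "n \<in> set \<pi>" using m set by auto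
      then obtain i where "i < n" "\<pi> ! i = n" using len by (auto simp: in_set_conv_nth)
      then have "\<pi> ! m = n" using bspec[OF *, of i] pm by simp
      then show ?thesis by simp
    qed
    then show "\<not> splits int ?Y ({..<n} - {m})" by (rule rem[OF m])
  qed
qed

theorem theorem2p5:
  fixes n k :: nat and \<pi> :: "nat list"
  assumes "int k \<le> 2 * int n - 7"
    and "\<pi> \<in> Av n k [1, 3, 2, 4]"
    and "indecomposable \<pi>"
  shows "almost_decomposable \<pi>"
proof (rule ccontr)
  assume nad: "\<not> almost_decomposable \<pi>"
  have p: "\<pi> \<in> perms n" and av: "avoids \<pi> [1, 3, 2, 4]" and k: "card (inversions \<pi>) = k"
    using assms(2) unfolding Av_def by auto
  have len: "length \<pi> = n" and dist: "distinct \<pi>" and set: "set \<pi> = {1..n}"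
    using p by (auto simp: permutations_of_set_def length_finite_permutations_of_set)
  have few: "card (inversions \<pi>) + 7 \<le> 2 * n" using assms(1) k by linarith
  let ?Y = "\<lambda>i. int (\<pi> ! i)" and ?V = "{..<n}"
  have rob: "robust int ?Y ?V" by (rule robust_if_not_almost_decomposable[OF p assms(3) nad])
  \<comment> \<open>The outermost cuts \<open>1\<close> and \<open>n - 1\<close> are left out, so that both sides of the cut contain a
    point besides the two crossing ones.\<close>
  have "\<exists>j. 2 \<le> j \<and> j + 2 \<le> n \<and> card {i. i < j \<and> j < \<pi> ! i} \<le> 1"
  proof (rule ccontr)
    assume "\<not> ?thesis"
    then have "(\<Sum>j\<in>{2..<n - 1}. 2) \<le> (\<Sum>j\<in>{2..<n - 1}. card {i. i < j \<and> j < \<pi> ! i})"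
      by (intro sum_mono) force
    also have "\<dots> \<le> (\<Sum>j\<in>{1..<n}. card {i. i < j \<and> j < \<pi> ! i})"
      by (intro sum_mono2) auto
    also have "\<dots> \<le> card (inversions \<pi>)" by (rule crossings_le_inversions[OF p])
    finally show False using few by simp
  qed
  then obtain j where j: "2 \<le> j" "j + 2 \<le> n" "card {i. i < j \<and> j < \<pi> ! i} \<le> 1" by blast
  define C where "C = {i. i < j \<and> j < \<pi> ! i}"
  define D where "D = {i. j \<le> i \<and> i < n \<and> \<pi> ! i \<le> j}"
  define P where "P = {i. i < j \<and> \<pi> ! i \<le> j}"
  define Q where "Q = {i. j \<le> i \<and> i < n \<and> j < \<pi> ! i}"
  have fin: "finite C" "finite D" "finite P" "finite Q"
    unfolding C_def D_def P_def Q_def by auto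
  have V: "?V = P \<union> C \<union> (Q \<union> D)" and Vl: "P \<union> C = {..<j}" and Vr: "Q \<union> D = {j..<n}"
    unfolding C_def D_def P_def Q_def using j(2) by auto
  have CD: "card D = card C" unfolding C_def D_def using card_crossings_eq[OF p] j(2) by simp
  have "card C \<noteq> 0"
  proof
    assume "card C = 0"
    then have "C = {}" "D = {}" using CD fin by auto
    then have PQ: "P = {..<j}" "Q = {j..<n}" using Vl Vr by simp_all
    have "splits int ?Y ?V"
    proof (rule splitsI[of P Q])
      show "P \<noteq> {}" "Q \<noteq> {}" unfolding PQ using j(1,2) by (simp_all add: lessThan_empty_iff)
      show "P \<union> Q = ?V" unfolding PQ using j(2) by auto
      show "int u < int v \<and> int (\<pi> ! u) < int (\<pi> ! v)" if "u \<in> P" "v \<in> Q" for u v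
        using that unfolding P_def Q_def by auto
    qed
    then show False using rob unfolding robust_def by blast
  qed
  then have "card C = 1" using j(3) unfolding C_def by linarith
  then obtain a b where b: "C = {b}" and a: "D = {a}"
    using CD by (metis card_1_singletonE)
  have "b \<in> C" "a \<in> D" using a b by auto
  then have ab: "b < j" "j < \<pi> ! b" "j \<le> a" "\<pi> ! a \<le> j" unfolding C_def D_def by auto
  have cut: "cut int ?Y P Q a b"
    using ab unfolding cut_def P_def Q_def by auto
  have "card (P \<union> C) \<le> card P + 1" "card (Q \<union> D) \<le> card Q + 1"
    using card_Un_le[of P C] card_Un_le[of Q D] a b by auto
  then have ne: "P \<noteq> {}" "Q \<noteq> {}" unfolding Vl Vr using j(1,2) by auto
  have "inj_on int ?V" "inj_on ?Y ?V"
    using dist len by (auto simp: inj_on_def nth_eq_iff_index_eq)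
  moreover have "?V = P \<union> Q \<union> {a, b}" unfolding V a b by blast
  moreover have "avoids_1324 int ?Y ?V" using avoids_1324_if_avoids[OF av] len by simp
  ultimately have "2 * card ?V \<le> card (inv_pairs int ?Y ?V) + 6"
    using cut_bound[OF cut _ _ _ _ rob _ ne] by blast
  moreover have "inv_pairs int ?Y ?V = inversions \<pi>"
    unfolding inv_pairs_def inversions_def using len by auto
  ultimately show False using few by simp
qed

end
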